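(* Let $\alpha\ge3$ be odd, $a<0$, and consider the planar map given in polar coordinates by $$r\mapsto f(r)=r+ar^{\alpha}+\mathcal{O}(r^{\alpha+1}),\qquad \varphi\mapsto g(\varphi)=\varphi+\Theta_0,$$ where the fixed rotation angle is rational: $\Theta_0=\frac{2\pi p}{q}$ for some coprime $p,q\in\mathbb{Z}$. Let $\Gamma(r_0,\varphi_0)$ be the discrete spiral with initial point $(r_0,\varphi_0)$. Then for $r_0>0$ small enough $$\dim_B\Gamma(r_0,\varphi_0)=1-\frac1\alpha .$$ Moreover, $\Gamma(r_0,\varphi_0)$ is Minkowski nondegenerate.
   Context: Discrete spiral: $\Gamma(r_0,\varphi_0)$ is the set of points of $\mathbb{R}^2$ with polar coordinates $(r_k,\varphi_k)$, where $(r_0,\varphi_0)$ is given and $r_k=f(r_{k-1})$, $\varphi_k=g(\varphi_{k-1})$ for $k\in\mathbb{N}$. Box dimension: for a bounded set $A\subset\mathbb{R}^N$ let $A_\varepsilon=\{y\in\mathbb{R}^N: d(y,A)<\varepsilon\}$, with Lebesgue measure $|A_\varepsilon|$. For $s\ge0$, $\mathcal{M}_*^s(A)=\liminf_{\varepsilon\to0}|A_\varepsilon|/\varepsilon^{N-s}$ and $\mathcal{M}^{*s}(A)=\limsup_{\varepsilon\to0}|A_\varepsilon|/\varepsilon^{N-s}$. The lower and upper box dimensions are $\underline{\dim}_BA=\inf\{s>0:\mathcal{M}_*^s(A)=0\}$ and $\overline{\dim}_BA=\inf\{s>0:\mathcal{M}^{*s}(A)=0\}$; if they coincide the common value is $\dim_BA$.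 The set $A$ is Minkowski nondegenerate if there is $d\ge0$ with $0<\mathcal{M}_*^d(A)\le\mathcal{M}^{*d}(A)<\infty$ (then $d=\dim_BA$). *)

theory Defs
  imports "HOL-Analysis.Analysis" "HOL-Library.Landau_Symbols"
begin

(* The guard "A \<noteq> {}" is the convention d(y, {}) = \<infinity>; the library has infdist y {} = 0. *)
definition eps_nbhd :: "real \<Rightarrow> 'a::euclidean_space set \<Rightarrow> 'a set" where
  "eps_nbhd \<epsilon> A = {y. A \<noteq> {} \<and> infdist y A < \<epsilon>}"

definition lower_minkowski_content :: "real \<Rightarrow> 'a::euclidean_space set \<Rightarrow> ennreal" where
  "lower_minkowski_content s A =
     Liminf (at_right 0)
       (\<lambda>\<epsilon>. emeasure lebesgue (eps_nbhd \<epsilon> A) / ennreal (\<epsilon> powr (real DIM('a) - s)))"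

definition upper_minkowski_content :: "real \<Rightarrow> 'a::euclidean_space set \<Rightarrow> ennreal" where
  "upper_minkowski_content s A =
     Limsup (at_right 0)
       (\<lambda>\<epsilon>. emeasure lebesgue (eps_nbhd \<epsilon> A) / ennreal (\<epsilon> powr (real DIM('a) - s)))"

(* For bounded A both sets below contain every s > DIM('a), so the infima are taken over
   nonempty sets bounded below by 0. The dimensions are only meaningful for bounded A. *)
definition lower_box_dim :: "'a::euclidean_space set \<Rightarrow> real" where
  "lower_box_dim A = Inf {s. s > 0 \<and> lower_minkowski_content s A = 0}"

definition upper_box_dim :: "'a::euclidean_space set \<Rightarrow> real" where
  "upper_box_dim A = Inf {s. s > 0 \<and> upper_minkowski_content s A = 0}"

definition has_box_dim :: "'a::euclidean_space set \<Rightarrow> real \<Rightarrow> bool" where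
  "has_box_dim A d \<longleftrightarrow> bounded A \<and> lower_box_dim A = d \<and> upper_box_dim A = d"

definition minkowski_nondegenerate :: "'a::euclidean_space set \<Rightarrow> bool" where
  "minkowski_nondegenerate A \<longleftrightarrow> bounded A \<and>
     (\<exists>d\<ge>0. 0 < lower_minkowski_content d A \<and>
        lower_minkowski_content d A \<le> upper_minkowski_content d A \<and>
        upper_minkowski_content d A < \<infinity>)"

definition polar_point :: "real \<Rightarrow> real \<Rightarrow> real ^ 2" where
  "polar_point r \<phi> = vector [r * cos \<phi>, r * sin \<phi>]"

definition discrete_spiral ::
    "(real \<Rightarrow> real) \<Rightarrow> (real \<Rightarrow> real) \<Rightarrow> real \<Rightarrow> real \<Rightarrow> (real ^ 2) set" where
  "discrete_spiral f g r0 \<phi>0 = {polar_point ((f ^^ k) r0) ((g ^^ k) \<phi>0) | k. True}"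

end

theory Submission
  imports Defs
begin

text \<open>
  Put \<open>m = \<alpha> - 1\<close> and \<open>d = 1 - 1 / \<alpha> = m / (m + 1)\<close>. It is enough to show that the
  area of the \<open>\<epsilon>\<close>-neighbourhood of the spiral is bounded above and below by
  positive multiples of \<open>\<epsilon> powr (2 - d)\<close> for small \<open>\<epsilon>\<close>: this determines both box
  dimensions and gives nondegeneracy (\<open>volume_bounds_imp_box_dim\<close>). By comparison of
  areas it then suffices to cover the spiral by, and to find in it a separated set of,
  about \<open>\<epsilon> powr (- d)\<close> points at scale \<open>\<epsilon>\<close>.

  The radii satisfy \<open>c * r k ^ \<alpha> \<le> r k - r (Suc k) \<le> C * r k ^ \<alpha>\<close>, hence
  \<open>1 / r k ^ m\<close> grows linearly in \<open>k\<close> (\<open>radial_decay\<close>). So the number of points whose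
  radius exceeds the threshold \<open>\<epsilon> powr (1 / \<alpha>)\<close> is of the order
  \<open>(\<epsilon> powr (1 / \<alpha>)) powr (- m) = \<epsilon> powr (- d)\<close>. The threshold is where the radial gap
  \<open>r ^ \<alpha>\<close> has size \<open>\<epsilon>\<close>. Above a multiple of it, different points have radii that
  differ by at least \<open>2 * \<epsilon>\<close>, whatever the angles are, and so they form a
  separated set (\<open>spiral_packing\<close>). For the upper bound (\<open>spiral_covering\<close>),
  rationality of the rotation puts the spiral on finitely many rays: the points below the
  threshold lie on finitely many segments of length \<open>\<epsilon> powr (1 / \<alpha>)\<close>, and such a segment
  needs only about \<open>\<epsilon> powr (1 / \<alpha>) / \<epsilon> = \<epsilon> powr (- d)\<close> balls. The two parts of the
  spiral thus contribute equally, which is the balance that fixes the dimension.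
\<close>

section \<open>Covering, packing and box dimension\<close>

lemma eps_nbhd_measurable: "eps_nbhd \<epsilon> A \<in> sets lebesgue"
proof -
  have "open (eps_nbhd \<epsilon> A)"
    unfolding eps_nbhd_def
    by (cases "A = {}") (auto intro!: open_Collect_less continuous_intros)
  then show ?thesis by (simp add: borel_open)
qed

text \<open>
  If every point of \<open>A\<close> is within \<open>\<epsilon>\<close> of a point of \<open>C\<close>, then every point of the
  neighbourhood is within \<open>2 * \<epsilon>\<close> of one, so the balls of that radius cover it.
\<close>

lemma covering_imp_volume_le:
  fixes A C :: "'a::euclidean_space set"
  assumes "finite C" and cover: "A \<subseteq> (\<Union>c\<in>C. cball c \<epsilon>)" and "0 < \<epsilon>"
  shows "emeasure lebesgue (eps_nbhd \<epsilon> A)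
    \<le> ennreal (real (card C) * (unit_ball_vol (DIM('a)) * (2 * \<epsilon>) ^ DIM('a)))"
proof -
  have "eps_nbhd \<epsilon> A \<subseteq> (\<Union>c\<in>C. ball c (2 * \<epsilon>))"
  proof
    fix y assume "y \<in> eps_nbhd \<epsilon> A"
    then have "A \<noteq> {}" "infdist y A < \<epsilon>" by (auto simp: eps_nbhd_def)
    then obtain x where "x \<in> A" "dist y x < \<epsilon>"
      by (metis infdist_notempty cINF_less_iff bdd_below_image_dist)
    moreover obtain c where "c \<in> C" "dist c x \<le> \<epsilon>"
      using cover \<open>x \<in> A\<close> by auto
    ultimately have "dist c y < 2 * \<epsilon>"
      using dist_triangle[of c y x] by (simp add: dist_commute)
    then show "y \<in> (\<Union>c\<in>C. ball c (2 * \<epsilon>))" using \<open>c \<in> C\<close> by auto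
  qed
  then have "emeasure lebesgue (eps_nbhd \<epsilon> A) \<le> emeasure lebesgue (\<Union>c\<in>C. ball c (2 * \<epsilon>))"
    using \<open>finite C\<close> by (intro emeasure_mono) auto
  also have "\<dots> \<le> (\<Sum>c\<in>C. emeasure lebesgue (ball c (2 * \<epsilon>)))"
    using \<open>finite C\<close> by (intro emeasure_subadditive_finite) auto
  also have "\<dots> = (\<Sum>c\<in>C. ennreal (unit_ball_vol (DIM('a)) * (2 * \<epsilon>) ^ DIM('a)))"
    using \<open>0 < \<epsilon>\<close> by (simp add: emeasure_ball)
  also have "\<dots> = ennreal (real (card C) * (unit_ball_vol (DIM('a)) * (2 * \<epsilon>) ^ DIM('a)))"
    using \<open>0 < \<epsilon>\<close> by (subst sum_ennreal) auto
  finally show ?thesis .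
qed

text \<open>
  The balls of radius \<open>\<epsilon>\<close> around the points of a \<open>2 * \<epsilon>\<close>-separated subset are disjoint
  and lie in the neighbourhood.
\<close>

lemma packing_imp_volume_ge:
  fixes A P :: "'a::euclidean_space set"
  assumes "finite P" "P \<subseteq> A" "0 < \<epsilon>"
    and sep: "\<And>x y. x \<in> P \<Longrightarrow> y \<in> P \<Longrightarrow> x \<noteq> y \<Longrightarrow> 2 * \<epsilon> \<le> dist x y"
  shows "ennreal (real (card P) * (unit_ball_vol (DIM('a)) * \<epsilon> ^ DIM('a)))
    \<le> emeasure lebesgue (eps_nbhd \<epsilon> A)"
proof -
  have sub: "(\<Union>x\<in>P. ball x \<epsilon>) \<subseteq> eps_nbhd \<epsilon> A"
  proof (clarsimp simp: eps_nbhd_def)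
    fix x y assume "x \<in> P" "dist x y < \<epsilon>"
    then show "A \<noteq> {} \<and> infdist y A < \<epsilon>"
      using \<open>P \<subseteq> A\<close> infdist_le[of x A y] by (auto simp: dist_commute)
  qed
  have disj: "disjoint_family_on (\<lambda>x. ball x \<epsilon>) P"
    unfolding disjoint_family_on_def
  proof (intro ballI impI)
    fix x y assume "x \<in> P" "y \<in> P" "x \<noteq> y"
    then show "ball x \<epsilon> \<inter> ball y \<epsilon> = {}"
      using sep[of x y] by (intro disjoint_ballI) simp
  qed
  have "ennreal (real (card P) * (unit_ball_vol (DIM('a)) * \<epsilon> ^ DIM('a)))
    = (\<Sum>x\<in>P. ennreal (unit_ball_vol (DIM('a)) * \<epsilon> ^ DIM('a)))"
    using \<open>0 < \<epsilon>\<close> by (subst sum_ennreal) auto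
  also have "\<dots> = (\<Sum>x\<in>P. emeasure lebesgue (ball x \<epsilon>))"
    using \<open>0 < \<epsilon>\<close> by (simp add: emeasure_ball)
  also have "\<dots> = emeasure lebesgue (\<Union>x\<in>P. ball x \<epsilon>)"
    using \<open>finite P\<close> disj by (intro sum_emeasure) auto
  also have "\<dots> \<le> emeasure lebesgue (eps_nbhd \<epsilon> A)"
    using sub eps_nbhd_measurable by (rule emeasure_mono)
  finally show ?thesis .
qed

text \<open>
  Up to the constants, the quotient that defines the \<open>s\<close>-dimensional content is
  \<open>\<epsilon> powr (s - d)\<close>. It tends to \<open>0\<close> for \<open>s > d\<close> and stays above a positive constant
  for \<open>s \<le> d\<close>, so for the lower and the upper content alike the orders at which the
  content vanishes are exactly those in \<open>{d<..}\<close>. The two contents at \<open>s = d\<close>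
  itself are caught between the constants, which is nondegeneracy.
\<close>

lemma volume_bounds_imp_box_dim:
  fixes A :: "'a::euclidean_space set"
  assumes "bounded A" "0 \<le> d" "0 < c" "0 < C"
    and lower: "eventually (\<lambda>\<epsilon>. ennreal (c * \<epsilon> powr (real DIM('a) - d))
      \<le> emeasure lebesgue (eps_nbhd \<epsilon> A)) (at_right 0)"
    and upper: "eventually (\<lambda>\<epsilon>. emeasure lebesgue (eps_nbhd \<epsilon> A)
      \<le> ennreal (C * \<epsilon> powr (real DIM('a) - d))) (at_right 0)"
  shows "has_box_dim A d \<and> minkowski_nondegenerate A"
proof -
  let ?N = "real DIM('a)"
  let ?V = "\<lambda>\<epsilon>. emeasure lebesgue (eps_nbhd \<epsilon> A)"
  have small: "eventually (\<lambda>\<epsilon>::real. 0 < \<epsilon> \<and> \<epsilon> < 1) (at_right 0)"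
    unfolding eventually_at_right_field by (rule exI[of _ 1]) auto
  have ratio: "ennreal (b * \<epsilon> powr (?N - d)) / ennreal (\<epsilon> powr (?N - s))
      = ennreal (b * \<epsilon> powr (s - d))" if "0 < \<epsilon>" "0 < b" for b \<epsilon> s :: real
    using that by (simp add: divide_ennreal powr_diff field_simps)
  have le: "lower_minkowski_content s A \<le> upper_minkowski_content s A" for s
    unfolding lower_minkowski_content_def upper_minkowski_content_def
    by (rule Liminf_le_Limsup) simp
  have low: "ennreal c \<le> lower_minkowski_content s A" if "s \<le> d" for s
    unfolding lower_minkowski_content_def
  proof (rule Liminf_bounded)
    show "\<forall>\<^sub>F \<epsilon> in at_right 0. ennreal c \<le> ?V \<epsilon> / ennreal (\<epsilon> powr (?N - s))"
      using lower small
    proof eventually_elim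
      case (elim \<epsilon>)
      have "1 \<le> \<epsilon> powr (s - d)"
        using elim that powr_mono'[of "s - d" 0 \<epsilon>] by simp
      then have "ennreal c \<le> ennreal (c * \<epsilon> powr (s - d))"
        using \<open>0 < c\<close> by (intro ennreal_leI) simp
      also have "\<dots> = ennreal (c * \<epsilon> powr (?N - d)) / ennreal (\<epsilon> powr (?N - s))"
        using elim \<open>0 < c\<close> by (simp add: ratio)
      also have "\<dots> \<le> ?V \<epsilon> / ennreal (\<epsilon> powr (?N - s))"
        using elim by (intro divide_right_mono_ennreal) auto
      finally show ?case .
    qed
  qed
  have up: "\<forall>\<^sub>F \<epsilon> in at_right 0. ?V \<epsilon> / ennreal (\<epsilon> powr (?N - s)) \<le> ennreal (C * \<epsilon> powr (s - d))"
    for s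
    using upper small
  proof eventually_elim
    case (elim \<epsilon>)
    have "?V \<epsilon> / ennreal (\<epsilon> powr (?N - s))
        \<le> ennreal (C * \<epsilon> powr (?N - d)) / ennreal (\<epsilon> powr (?N - s))"
      using elim by (intro divide_right_mono_ennreal) auto
    also have "\<dots> = ennreal (C * \<epsilon> powr (s - d))"
      using elim \<open>0 < C\<close> by (simp add: ratio)
    finally show ?case .
  qed
  have zero: "upper_minkowski_content s A = 0" if "d < s" for s
  proof -
    have "((\<lambda>\<epsilon>::real. \<epsilon> powr (s - d)) \<longlongrightarrow> 0) (at_right 0)"
      using that small
      by (intro tendsto_zero_powrI[where b = "s - d"])
         (auto intro: tendsto_ident_at elim!: eventually_mono)
    then have "((\<lambda>\<epsilon>. ennreal (C * \<epsilon> powr (s - d))) \<longlongrightarrow> ennreal (C * 0)) (at_right 0)"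
      by (intro tendsto_ennrealI tendsto_mult tendsto_const)
    then have "Limsup (at_right 0) (\<lambda>\<epsilon>. ennreal (C * \<epsilon> powr (s - d))) = 0"
      by (simp add: lim_imp_Limsup)
    then show ?thesis
      unfolding upper_minkowski_content_def using Limsup_mono[OF up[of s]] by simp
  qed
  have fin: "upper_minkowski_content d A \<le> ennreal C"
    unfolding upper_minkowski_content_def
  proof (rule Limsup_bounded)
    show "\<forall>\<^sub>F \<epsilon> in at_right 0. ?V \<epsilon> / ennreal (\<epsilon> powr (?N - d)) \<le> ennreal C"
      using up[of d] small by eventually_elim simp
  qed
  have pos: "0 < lower_minkowski_content s A" if "s \<le> d" for s
    using low[OF that] \<open>0 < c\<close> by (metis ennreal_less_zero_iff less_le_trans)
  have "{s. s > 0 \<and> lower_minkowski_content s A = 0} = {d<..}"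
    using pos zero le \<open>0 \<le> d\<close>
    by (auto simp: not_le[symmetric]) (metis le_zero_eq not_le)+
  moreover have "{s. s > 0 \<and> upper_minkowski_content s A = 0} = {d<..}"
    using pos zero le \<open>0 \<le> d\<close>
    by (auto simp: not_le[symmetric]) (metis le_zero_eq not_le)+
  ultimately have "has_box_dim A d"
    unfolding has_box_dim_def lower_box_dim_def upper_box_dim_def
    using \<open>bounded A\<close> by simp
  moreover have "upper_minkowski_content d A < \<infinity>"
    using fin by (simp add: le_less_trans)
  then have "minkowski_nondegenerate A"
    unfolding minkowski_nondegenerate_def
    using \<open>bounded A\<close> \<open>0 \<le> d\<close> pos[of d] le[of d] by blast
  ultimately show ?thesis ..
qed

section \<open>Radial decay\<close>

text \<open>
  The quantity \<open>1 / x ^ m\<close> linearizes the dynamics: it plays the role of time in the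
  equation \<open>x' = - c * x ^ (m + 1)\<close>, where it grows at the constant rate \<open>m * c\<close>.
  This lemma and the next are the discrete versions, with cruder constants. With
  \<open>t = c * x ^ m\<close> the step multiplies \<open>x\<close> by at most \<open>1 - t\<close>, and
  \<open>(1 + t) * (1 - t) \<le> 1\<close>.
\<close>

lemma inverse_power_step_ge:
  fixes x y c :: real
  assumes "0 < x" "0 < y" "0 \<le> c" "1 \<le> m" and step: "y \<le> x - c * x ^ (m + 1)"
  shows "1 / x ^ m + c \<le> 1 / y ^ m"
proof -
  define t where "t = c * x ^ m"
  have "0 \<le> t" using assms by (simp add: t_def)
  have y: "y \<le> x * (1 - t)" using step by (simp add: t_def algebra_simps)
  then have "0 < x * (1 - t)" using \<open>0 < y\<close> by linarith
  then have "t < 1" using \<open>0 < x\<close> by (simp add: zero_less_mult_iff)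
  have "y ^ m \<le> (x * (1 - t)) ^ m" using y \<open>0 < y\<close> by (intro power_mono) auto
  also have "\<dots> \<le> x ^ m * (1 - t)"
    using \<open>0 \<le> t\<close> \<open>t < 1\<close> \<open>0 < x\<close> \<open>1 \<le> m\<close> power_decreasing[of 1 m "1 - t"]
    by (simp add: power_mult_distrib)
  finally have "(1 + t) * y ^ m \<le> (1 + t) * (x ^ m * (1 - t))"
    using \<open>0 \<le> t\<close> by (intro mult_left_mono) auto
  also have "\<dots> = x ^ m * (1 - t\<^sup>2)" by (simp add: algebra_simps power2_eq_square)
  also have "\<dots> \<le> x ^ m" using \<open>0 < x\<close> by simp
  finally have "(1 + t) / x ^ m \<le> 1 / y ^ m" using assms by (simp add: field_simps)
  then show ?thesis using \<open>0 < x\<close> by (simp add: t_def field_simps)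
qed

text \<open>
  Now \<open>x\<close> is multiplied by at least \<open>1 - t\<close>, and Bernoulli's inequality gives
  \<open>(1 - t) ^ m \<ge> 1 - s\<close> for \<open>s = m * t\<close>. The smallness hypothesis \<open>s \<le> 1 / 2\<close> is what
  makes \<open>1 / (1 - s) \<le> 1 + 2 * s\<close> true.
\<close>

lemma inverse_power_step_le:
  fixes x y c :: real
  assumes "0 < x" "0 < y" "0 \<le> c" "1 \<le> m" and small: "real m * c * x ^ m \<le> 1 / 2"
    and step: "x - c * x ^ (m + 1) \<le> y"
  shows "1 / y ^ m \<le> 1 / x ^ m + 2 * real m * c"
proof -
  define t where "t = c * x ^ m"
  define s where "s = real m * t"
  have "0 \<le> t" and s: "0 \<le> s" "s \<le> 1 / 2"
    using assms by (auto simp: t_def s_def mult.assoc)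
  have "1 * t \<le> s"
    unfolding s_def using \<open>0 \<le> t\<close> \<open>1 \<le> m\<close> by (intro mult_right_mono) auto
  then have t: "0 \<le> t" "t \<le> 1" using \<open>0 \<le> t\<close> s by auto
  have "1 - s \<le> (1 - t) ^ m"
    using Bernoulli_inequality[of "- t" m] t by (simp add: s_def)
  then have "x ^ m * (1 - s) \<le> (x * (1 - t)) ^ m"
    using \<open>0 < x\<close> by (simp add: power_mult_distrib)
  also have "\<dots> \<le> y ^ m"
    using step t \<open>0 < x\<close> by (intro power_mono) (auto simp: t_def algebra_simps)
  finally have le: "x ^ m * (1 - s) \<le> y ^ m" .
  have "0 \<le> s * (1 - 2 * s)" using s by simp
  then have "1 \<le> (1 + 2 * s) * (1 - s)" by (simp add: algebra_simps)
  then have "x ^ m * 1 \<le> x ^ m * ((1 + 2 * s) * (1 - s))"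
    using \<open>0 < x\<close> by (intro mult_left_mono) auto
  also have "\<dots> = (1 + 2 * s) * (x ^ m * (1 - s))" by simp
  also have "\<dots> \<le> (1 + 2 * s) * y ^ m" using le s by (intro mult_left_mono) auto
  finally have "1 / y ^ m \<le> (1 + 2 * s) / x ^ m" using assms by (simp add: field_simps)
  then show ?thesis using \<open>0 < x\<close> by (simp add: s_def t_def field_simps)
qed

text \<open>
  Summing the increments of \<open>1 / r k ^ m\<close> shows that \<open>r k\<close> is of the order of
  \<open>k powr (- 1 / m)\<close>, in a form that avoids fractional powers.
\<close>

lemma radial_decay:
  fixes r :: "nat \<Rightarrow> real"
  assumes "1 \<le> m" "0 < c" "0 < C" and pos: "\<And>k. 0 < r k"
    and small: "\<And>k. real m * C * r k ^ m \<le> 1 / 2"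
    and upper: "\<And>k. r (Suc k) \<le> r k - c * r k ^ (m + 1)"
    and lower: "\<And>k. r k - C * r k ^ (m + 1) \<le> r (Suc k)"
  shows "c * real k \<le> 1 / r k ^ m"
    and "1 / r k ^ m \<le> 1 / r 0 ^ m + 2 * real m * C * real k"
proof -
  show "c * real k \<le> 1 / r k ^ m"
  proof (induction k)
    case 0
    then show ?case using pos[of 0] by simp
  next
    case (Suc k)
    have "1 / r k ^ m + c \<le> 1 / r (Suc k) ^ m"
      using assms(1) \<open>0 < c\<close> pos upper by (intro inverse_power_step_ge) auto
    then show ?case using Suc by (simp add: algebra_simps)
  qed
  show "1 / r k ^ m \<le> 1 / r 0 ^ m + 2 * real m * C * real k"
  proof (induction k)
    case (Suc k)
    have "1 / r (Suc k) ^ m \<le> 1 / r k ^ m + 2 * real m * C"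
      using assms(1) \<open>0 < C\<close> pos small lower by (intro inverse_power_step_le) auto
    then show ?case using Suc by (simp add: algebra_simps)
  qed simp
qed

section \<open>Covering and packing a spiral on finitely many rays\<close>

lemma norm_polar_point: "norm (polar_point r \<phi>) = \<bar>r\<bar>"
proof -
  have "(r * cos \<phi>)\<^sup>2 + (r * sin \<phi>)\<^sup>2 = r\<^sup>2 * ((cos \<phi>)\<^sup>2 + (sin \<phi>)\<^sup>2)"
    by (simp only: power_mult_distrib distrib_left)
  then show ?thesis
    by (simp add: polar_point_def norm_vec_def L2_set_def sum_2)
qed

lemma dist_polar_point_same_angle: "dist (polar_point r \<phi>) (polar_point s \<phi>) = \<bar>r - s\<bar>"
proof -
  have "polar_point r \<phi> - polar_point s \<phi> = polar_point (r - s) \<phi>"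
    by (simp add: polar_point_def vec_eq_iff forall_2 algebra_simps)
  then show ?thesis by (metis dist_norm norm_polar_point)
qed

text \<open>
  Separation by radius alone: this is why the lower volume bound does not depend on the
  angles of the spiral.
\<close>

lemma dist_polar_point_ge: "\<bar>r\<bar> - \<bar>s\<bar> \<le> dist (polar_point r \<phi>) (polar_point s \<psi>)"
  using norm_triangle_ineq2[of "polar_point r \<phi>" "polar_point s \<psi>"]
  by (simp add: dist_norm norm_polar_point)

text \<open>
  The threshold radius is \<open>\<epsilon> powr (1 / (m + 1))\<close>, where the gap between consecutive
  radii, of order \<open>r ^ (m + 1)\<close>, becomes comparable to \<open>\<epsilon>\<close>. About
  \<open>\<epsilon> powr (- d) / c\<close> points lie above the threshold, and each is covered by its own ball.
  Below it the points are too crowded to be counted, but they lie on \<open>Q\<close> segments of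
  that length, each covered by about \<open>\<epsilon> powr (1 / (m + 1)) / \<epsilon> = \<epsilon> powr (- d)\<close>
  balls centred at a grid of mesh \<open>\<epsilon>\<close>. This is where finiteness of the number of rays matters.
\<close>

lemma spiral_covering:
  fixes r \<phi> :: "nat \<Rightarrow> real" and m Q :: nat
  defines "d \<equiv> real m / real (m + 1)"
  assumes "1 \<le> m" "0 < c" "0 < Q" and pos: "\<And>k. 0 < r k"
    and decay: "\<And>k. c * real k \<le> 1 / r k ^ m"
    and rays: "\<And>x k. polar_point x (\<phi> k) = polar_point x (\<phi> (k mod Q))"
    and "0 < \<epsilon>" "\<epsilon> < 1"
  shows "\<exists>S. finite S \<and> range (\<lambda>k. polar_point (r k) (\<phi> k)) \<subseteq> (\<Union>x\<in>S. cball x \<epsilon>) \<and>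
    real (card S) \<le> (1 / c + 1 + 2 * real Q) * \<epsilon> powr (- d)"
proof -
  define X where "X = \<epsilon> powr (- d)"
  define K where "K = nat \<lceil>X / c\<rceil>"
  define L where "L = nat \<lfloor>X\<rfloor>"
  define head where "head = (\<lambda>k. polar_point (r k) (\<phi> k)) ` {..<K}"
  define grid where
    "grid = (\<lambda>(i, j). polar_point (real i * \<epsilon>) (\<phi> j)) ` ({..L} \<times> {..<Q})"
  have X1: "1 \<le> X"
    using \<open>0 < \<epsilon>\<close> \<open>\<epsilon> < 1\<close> powr_mono'[of "- d" 0 \<epsilon>] by (simp add: X_def d_def)
  have K: "X / c \<le> real K" "real K \<le> X / c + 1"
    using X1 \<open>0 < c\<close> by (auto simp: K_def)
  have L: "real L \<le> X" "X < real L + 1"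
    using X1 by (auto simp: L_def)
  have dm: "1 - d = 1 / real (m + 1)" by (simp add: d_def field_simps)
  \<comment> \<open>Here \<open>\<epsilon> * X\<close> is the threshold \<open>\<epsilon> powr (1 / (m + 1))\<close>, since \<open>1 - d = 1 / (m + 1)\<close>.\<close>
  have tail: "r k \<le> \<epsilon> * X" if "K \<le> k" for k
  proof -
    have "X \<le> c * real K" using K(1) \<open>0 < c\<close> by (simp add: field_simps)
    also have "\<dots> \<le> c * real k" using that \<open>0 < c\<close> by simp
    also have "\<dots> \<le> 1 / r k ^ m" by (rule decay)
    finally have "r k ^ m \<le> 1 / X" using X1 pos[of k] by (simp add: field_simps)
    also have "1 / X = \<epsilon> powr d" by (simp add: X_def powr_minus field_simps)
    also have "\<dots> = (\<epsilon> powr (1 / real (m + 1))) powr real m" by (simp add: powr_powr d_def)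
    also have "\<dots> = (\<epsilon> powr (1 / real (m + 1))) ^ m"
      using \<open>0 < \<epsilon>\<close> by (simp add: powr_realpow)
    finally have "r k \<le> \<epsilon> powr (1 / real (m + 1))"
      using \<open>1 \<le> m\<close> pos[of k] by (simp add: power_mono_iff less_imp_le)
    also have "\<dots> = \<epsilon> powr (1 + - d)" by (simp only: dm[symmetric] diff_conv_add_uminus)
    also have "\<dots> = \<epsilon> * X" using \<open>0 < \<epsilon>\<close> by (simp only: powr_add X_def powr_one)
    finally show ?thesis .
  qed
  have "\<exists>x\<in>head \<union> grid. polar_point (r k) (\<phi> k) \<in> cball x \<epsilon>" for k
  proof (cases "k < K")
    case True
    then show ?thesis
      using \<open>0 < \<epsilon>\<close> by (intro bexI[of _ "polar_point (r k) (\<phi> k)"]) (auto simp: head_def)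
  next
    case False
    define i where "i = nat \<lfloor>r k / \<epsilon>\<rfloor>"
    have "0 \<le> r k / \<epsilon>" using pos[of k] \<open>0 < \<epsilon>\<close> by simp
    then have i: "real i \<le> r k / \<epsilon>" "r k / \<epsilon> < real i + 1" by (auto simp: i_def)
    have "r k / \<epsilon> \<le> X" using tail[of k] False \<open>0 < \<epsilon>\<close> by (simp add: field_simps)
    then have "i \<le> L" by (auto simp: i_def L_def intro!: nat_mono floor_mono)
    then have "polar_point (real i * \<epsilon>) (\<phi> (k mod Q)) \<in> grid"
      using \<open>0 < Q\<close> by (auto simp: grid_def intro!: image_eqI[of _ _ "(i, k mod Q)"])
    moreover have "\<bar>real i * \<epsilon> - r k\<bar> \<le> \<epsilon>"
      using i \<open>0 < \<epsilon>\<close> by (simp add: field_simps abs_le_iff)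
    then have "dist (polar_point (real i * \<epsilon>) (\<phi> (k mod Q))) (polar_point (r k) (\<phi> k)) \<le> \<epsilon>"
      by (simp add: rays[of "r k" k] dist_polar_point_same_angle)
    ultimately show ?thesis
      by (auto intro!: bexI[of _ "polar_point (real i * \<epsilon>) (\<phi> (k mod Q))"])
  qed
  then have "range (\<lambda>k. polar_point (r k) (\<phi> k)) \<subseteq> (\<Union>x\<in>head \<union> grid. cball x \<epsilon>)" by blast
  moreover have "finite (head \<union> grid)" by (simp add: head_def grid_def)
  moreover have "real (card (head \<union> grid)) \<le> (1 / c + 1 + 2 * real Q) * X"
  proof -
    have "card head \<le> K" unfolding head_def by (metis card_image_le card_lessThan finite_lessThan)
    moreover have "card grid \<le> (L + 1) * Q"
      unfolding grid_def by (rule order_trans[OF card_image_le]) (auto simp: card_cartesian_product)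
    ultimately have "card (head \<union> grid) \<le> K + (L + 1) * Q"
      using card_Un_le[of head grid] by linarith
    then have "real (card (head \<union> grid)) \<le> real K + (real L + 1) * real Q"
      by (metis of_nat_1 of_nat_add of_nat_le_iff of_nat_mult)
    also have "\<dots> \<le> (X / c + X) + (X + X) * real Q"
      using K L X1 by (intro add_mono mult_right_mono) auto
    finally show ?thesis by (simp add: algebra_simps)
  qed
  ultimately show ?thesis unfolding X_def by blast
qed

text \<open>
  As long as \<open>c * r k ^ (m + 1) \<ge> 2 * \<epsilon>\<close>, the radius drops by at least \<open>2 * \<epsilon>\<close> in
  the next step, so these early points are \<open>2 * \<epsilon>\<close>-separated by their radii. The upper
  bound on \<open>1 / r k ^ m\<close> says that the condition persists for about
  \<open>(2 * \<epsilon> / c) powr (- d) / C\<close> steps; half of that number absorbs the initial value \<open>B\<close>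
  once \<open>\<epsilon>\<close> is small.
\<close>

lemma spiral_packing:
  fixes r \<phi> :: "nat \<Rightarrow> real" and m :: nat
  defines "d \<equiv> real m / real (m + 1)"
  assumes "1 \<le> m" "0 < c" "0 < C" and pos: "\<And>k. 0 < r k"
    and gap: "\<And>k. r (Suc k) \<le> r k - c * r k ^ (m + 1)"
    and slow: "\<And>k. 1 / r k ^ m \<le> B + C * real k"
    and "0 < \<epsilon>" and small: "2 * B \<le> (2 * \<epsilon> / c) powr (- d)"
  shows "\<exists>P. finite P \<and> P \<subseteq> range (\<lambda>k. polar_point (r k) (\<phi> k)) \<and>
    (\<forall>x\<in>P. \<forall>y\<in>P. x \<noteq> y \<longrightarrow> 2 * \<epsilon> \<le> dist x y) \<and>
    (2 * \<epsilon> / c) powr (- d) / (2 * C) \<le> real (card P)"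
proof -
  \<comment> \<open>\<open>h\<close> is the value that \<open>r k ^ (m + 1)\<close> must reach for a gap of \<open>2 * \<epsilon>\<close>.\<close>
  define h where "h = 2 * \<epsilon> / c"
  define Y where "Y = h powr (- d) / (2 * C)"
  define K where "K = nat \<lfloor>Y\<rfloor>"
  define pt where "pt k = polar_point (r k) (\<phi> k)" for k
  have h: "0 < h" using \<open>0 < \<epsilon>\<close> \<open>0 < c\<close> by (simp add: h_def)
  have "0 \<le> Y" using \<open>0 < C\<close> by (simp add: Y_def)
  then have K: "real K \<le> Y" "Y < real K + 1" by (auto simp: K_def)
  have large_gap: "2 * \<epsilon> \<le> r k - r (Suc k)" if "k \<le> K" for k
  proof -
    have "1 / r k ^ m \<le> B + C * real k" by (rule slow)
    also have "\<dots> \<le> h powr (- d) / 2 + C * Y"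
      using small that K(1) \<open>0 < C\<close> by (intro add_mono mult_left_mono) (auto simp: h_def)
    also have "\<dots> = h powr (- d)" using \<open>0 < C\<close> by (simp add: Y_def)
    finally have "h powr d \<le> r k ^ m"
      using h pos[of k] by (simp add: powr_minus field_simps)
    also have "h powr d = (h powr (1 / real (m + 1))) powr real m" by (simp add: powr_powr d_def)
    also have "\<dots> = (h powr (1 / real (m + 1))) ^ m" using h by (simp add: powr_realpow)
    finally have "h powr (1 / real (m + 1)) \<le> r k"
      using \<open>1 \<le> m\<close> pos[of k] by (simp add: power_mono_iff less_imp_le)
    then have "(h powr (1 / real (m + 1))) ^ (m + 1) \<le> r k ^ (m + 1)"
      by (intro power_mono) auto
    also have "(h powr (1 / real (m + 1))) ^ (m + 1) = h"
      using h by (simp add: powr_realpow[symmetric] powr_powr del: power_Suc of_nat_Suc of_nat_add)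
    finally have "c * h \<le> c * r k ^ (m + 1)" using \<open>0 < c\<close> by (intro mult_left_mono) auto
    then show ?thesis using gap[of k] \<open>0 < c\<close> by (simp add: h_def)
  qed
  have anti: "r j \<le> r i" if "i \<le> j" for i j
  proof (rule lift_Suc_antimono_le[OF _ that])
    show "r (Suc k) \<le> r k" for k
      using gap[of k] \<open>0 < c\<close> pos[of k] by (smt (verit) mult_pos_pos zero_less_power)
  qed
  have sep: "2 * \<epsilon> \<le> dist (pt i) (pt j)" if "i < j" "j \<le> K" for i j
  proof -
    have "2 * \<epsilon> \<le> r i - r (Suc i)" using that by (intro large_gap) auto
    also have "\<dots> \<le> r i - r j" using that anti[of "Suc i" j] by simp
    also have "\<dots> = \<bar>r i\<bar> - \<bar>r j\<bar>" using pos[of i] pos[of j] by simp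
    also have "\<dots> \<le> dist (pt i) (pt j)" unfolding pt_def by (rule dist_polar_point_ge)
    finally show ?thesis .
  qed
  have sep': "2 * \<epsilon> \<le> dist (pt i) (pt j)" if "i \<le> K" "j \<le> K" "i \<noteq> j" for i j
    using sep[of i j] sep[of j i] that by (cases "i < j") (auto simp: dist_commute)
  then have "inj_on pt {..K}"
    using \<open>0 < \<epsilon>\<close> by (intro inj_onI) (force simp: not_le)
  then have "card (pt ` {..K}) = card {..K}" by (rule card_image)
  then have "Y \<le> real (card (pt ` {..K}))" using K(2) by simp
  moreover have "\<forall>x\<in>pt ` {..K}. \<forall>y\<in>pt ` {..K}. x \<noteq> y \<longrightarrow> 2 * \<epsilon> \<le> dist x y"
    using sep' by auto
  moreover have "finite (pt ` {..K})" "pt ` {..K} \<subseteq> range pt" by auto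
  ultimately show ?thesis unfolding Y_def h_def pt_def[abs_def] by blast
qed

text \<open>
  In the plane a ball of radius \<open>\<epsilon>\<close> has area of order \<open>\<epsilon>\<^sup>2\<close>, so covering and packing by
  about \<open>\<epsilon> powr (- d)\<close> balls pin the area of the neighbourhood to the order
  \<open>\<epsilon> powr (2 - d)\<close>.
\<close>

lemma spiral_box_dim:
  fixes r \<phi> :: "nat \<Rightarrow> real" and m Q :: nat
  defines "d \<equiv> real m / real (m + 1)"
  assumes "1 \<le> m" "0 < c" "0 < C" "0 < Q" and pos: "\<And>k. 0 < r k"
    and small: "\<And>k. real m * C * r k ^ m \<le> 1 / 2"
    and upper: "\<And>k. r (Suc k) \<le> r k - c * r k ^ (m + 1)"
    and lower: "\<And>k. r k - C * r k ^ (m + 1) \<le> r (Suc k)"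
    and rays: "\<And>x k. polar_point x (\<phi> k) = polar_point x (\<phi> (k mod Q))"
  shows "has_box_dim (range (\<lambda>k. polar_point (r k) (\<phi> k))) d \<and>
    minkowski_nondegenerate (range (\<lambda>k. polar_point (r k) (\<phi> k)))"
proof -
  define A where "A = range (\<lambda>k. polar_point (r k) (\<phi> k))"
  define V where "V = unit_ball_vol (DIM(real ^ 2))"
  define M where "M = 1 / c + 1 + 2 * real Q"
  define B where "B = 1 / r 0 ^ m"
  define D where "D = 2 * real m * C"
  note decay = radial_decay[of m c C r, OF \<open>1 \<le> m\<close> \<open>0 < c\<close> \<open>0 < C\<close> pos small upper lower]
  note cover = spiral_covering[of m c Q r \<phi>, OF \<open>1 \<le> m\<close> \<open>0 < c\<close> \<open>0 < Q\<close> pos decay(1) rays,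
      folded d_def A_def M_def]
  have "0 < V" by (simp add: V_def)
  have "0 < M" using \<open>0 < c\<close> by (simp add: M_def add_pos_nonneg)
  have "0 < D" using \<open>1 \<le> m\<close> \<open>0 < C\<close> by (simp add: D_def)
  have "0 < B" using pos[of 0] by (simp add: B_def)
  have "0 < d" using \<open>1 \<le> m\<close> by (simp add: d_def)
  have square: "\<epsilon> powr (- d) * \<epsilon>\<^sup>2 = \<epsilon> powr (2 - d)" if "0 < \<epsilon>" for \<epsilon> :: real
    using that powr_add[of \<epsilon> "- d" 2] by (simp add: powr_numeral)
  have "bounded A"
  proof -
    obtain S where "finite S" "A \<subseteq> (\<Union>x\<in>S. cball x (1 / 2))" using cover[of "1 / 2"] by auto
    then show ?thesis by (meson bounded_UN bounded_cball bounded_subset)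
  qed
  moreover have "\<forall>\<^sub>F \<epsilon> in at_right 0. emeasure lebesgue (eps_nbhd \<epsilon> A)
      \<le> ennreal (4 * M * V * \<epsilon> powr (real DIM(real ^ 2) - d))"
    unfolding eventually_at_right_field
  proof (intro exI[of _ 1] conjI allI impI)
    fix \<epsilon> :: real assume "0 < \<epsilon>" "\<epsilon> < 1"
    then obtain S where S: "finite S" "A \<subseteq> (\<Union>x\<in>S. cball x \<epsilon>)"
      "real (card S) \<le> M * \<epsilon> powr (- d)" using cover by blast
    have "emeasure lebesgue (eps_nbhd \<epsilon> A)
        \<le> ennreal (real (card S) * (V * (2 * \<epsilon>) ^ DIM(real ^ 2)))"
      unfolding V_def by (rule covering_imp_volume_le[OF S(1,2) \<open>0 < \<epsilon>\<close>])
    also have "\<dots> \<le> ennreal (M * \<epsilon> powr (- d) * (V * (2 * \<epsilon>) ^ DIM(real ^ 2)))"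
      using S(3) \<open>0 < V\<close> \<open>0 < \<epsilon>\<close> by (intro ennreal_leI mult_right_mono) auto
    also have "M * \<epsilon> powr (- d) * (V * (2 * \<epsilon>) ^ DIM(real ^ 2))
        = 4 * M * V * (\<epsilon> powr (- d) * \<epsilon>\<^sup>2)"
      by (simp add: power_mult_distrib)
    also have "\<dots> = 4 * M * V * \<epsilon> powr (real DIM(real ^ 2) - d)"
      by (simp add: square[OF \<open>0 < \<epsilon>\<close>])
    finally show "emeasure lebesgue (eps_nbhd \<epsilon> A)
      \<le> ennreal (4 * M * V * \<epsilon> powr (real DIM(real ^ 2) - d))" .
  qed simp
  moreover have "\<forall>\<^sub>F \<epsilon> in at_right 0.
      ennreal ((2 / c) powr (- d) / (2 * D) * V * \<epsilon> powr (real DIM(real ^ 2) - d))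
      \<le> emeasure lebesgue (eps_nbhd \<epsilon> A)"
  proof -
    have gt0: "\<forall>\<^sub>F \<epsilon>::real in at_right 0. 0 < \<epsilon>" by (simp add: eventually_at_right_less)
    have "((\<lambda>\<epsilon>. 2 * \<epsilon> / c) \<longlongrightarrow> 2 * 0 / c) (at_right 0)"
      using \<open>0 < c\<close> by (intro tendsto_intros) auto
    then have "((\<lambda>\<epsilon>. (2 * \<epsilon> / c) powr d) \<longlongrightarrow> 0) (at_right 0)"
      using \<open>0 < d\<close> \<open>0 < c\<close> gt0
      by (intro tendsto_zero_powrI[where b = d]) (auto elim!: eventually_mono)
    then have "\<forall>\<^sub>F \<epsilon> in at_right 0. (2 * \<epsilon> / c) powr d < 1 / (2 * B)"
      using \<open>0 < B\<close> by (intro order_tendstoD(2)) auto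
    then show ?thesis using gt0
    proof eventually_elim
      case (elim \<epsilon>)
      have "2 * B \<le> (2 * \<epsilon> / c) powr (- d)"
        using elim \<open>0 < B\<close> \<open>0 < c\<close> by (simp add: powr_minus field_simps)
      from spiral_packing[of m c D r B _ \<phi>, OF \<open>1 \<le> m\<close> \<open>0 < c\<close> \<open>0 < D\<close> pos upper
          decay(2)[folded B_def D_def] elim(2) this[unfolded d_def], folded d_def]
      obtain P where P: "finite P" "P \<subseteq> A"
        "\<And>x y. x \<in> P \<Longrightarrow> y \<in> P \<Longrightarrow> x \<noteq> y \<Longrightarrow> 2 * \<epsilon> \<le> dist x y"
        "(2 * \<epsilon> / c) powr (- d) / (2 * D) \<le> real (card P)"
        unfolding A_def by blast
      have "(2 * \<epsilon> / c) powr (- d) = (2 / c) powr (- d) * \<epsilon> powr (- d)"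
        using elim \<open>0 < c\<close> powr_mult[of "2 / c" \<epsilon> "- d"] by simp
      then have "(2 / c) powr (- d) / (2 * D) * V * \<epsilon> powr (real DIM(real ^ 2) - d)
          = (2 * \<epsilon> / c) powr (- d) / (2 * D) * (V * \<epsilon> ^ DIM(real ^ 2))"
        by (simp add: square[OF elim(2), symmetric])
      also have "\<dots> \<le> real (card P) * (V * \<epsilon> ^ DIM(real ^ 2))"
        using P(4) \<open>0 < V\<close> elim by (intro mult_right_mono) auto
      finally have "ennreal ((2 / c) powr (- d) / (2 * D) * V * \<epsilon> powr (real DIM(real ^ 2) - d))
          \<le> ennreal (real (card P) * (V * \<epsilon> ^ DIM(real ^ 2)))" by (rule ennreal_leI)
      also have "\<dots> \<le> emeasure lebesgue (eps_nbhd \<epsilon> A)"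
        unfolding V_def by (rule packing_imp_volume_ge[OF P(1,2) elim(2) P(3)])
      finally show ?case .
    qed
  qed
  ultimately show ?thesis
    unfolding A_def[symmetric]
    using \<open>0 < d\<close> \<open>0 < c\<close> \<open>0 < D\<close> \<open>0 < M\<close> \<open>0 < V\<close>
    by (intro volume_bounds_imp_box_dim[where c = "(2 / c) powr (- d) / (2 * D) * V"
          and C = "4 * M * V"]) simp_all
qed

section \<open>Weakly attracting maps with rational rotation\<close>

text \<open>
  Near \<open>0\<close> the remainder is at most half the size of the leading term
  \<open>a * r ^ (m + 1)\<close>, so the decrement of the radius lies between one half and three halves of
  \<open>- a * r ^ (m + 1)\<close>. This explains the constants \<open>c\<close> and \<open>C\<close>.
\<close>

lemma weakly_attracting_near_0:
  fixes f :: "real \<Rightarrow> real" and a :: real and m :: nat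
  assumes "1 \<le> m" "a < 0"
    and f: "(\<lambda>r. f r - (r + a * r ^ (m + 1))) \<in> O[at_right 0](\<lambda>r. r ^ (m + 2))"
  defines "c \<equiv> - a / 2" and "C \<equiv> - 3 * a / 2"
  obtains \<rho> where "0 < \<rho>" and "\<And>r. 0 < r \<Longrightarrow> r < \<rho> \<Longrightarrow>
    0 < f r \<and> f r \<le> r - c * r ^ (m + 1) \<and> r - C * r ^ (m + 1) \<le> f r \<and> real m * C * r ^ m \<le> 1 / 2"
proof -
  obtain B where "0 < B" and
    B: "\<forall>\<^sub>F r in at_right 0. norm (f r - (r + a * r ^ (m + 1))) \<le> B * norm (r ^ (m + 2))"
    using f by (elim landau_o.bigE)
  have "((\<lambda>r. B * r) \<longlongrightarrow> B * 0) (at_right (0::real))" by (intro tendsto_intros)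
  then have "\<forall>\<^sub>F r in at_right 0. B * r < - a / 2"
    using \<open>a < 0\<close> by (intro order_tendstoD(2)) auto
  moreover have "((\<lambda>r. real m * C * r ^ m) \<longlongrightarrow> real m * C * 0 ^ m) (at_right (0::real))"
    by (intro tendsto_intros)
  then have "\<forall>\<^sub>F r in at_right 0. real m * C * r ^ m < 1 / 2"
    using \<open>1 \<le> m\<close> by (intro order_tendstoD(2)) (auto simp: power_0_left)
  moreover have "\<forall>\<^sub>F r::real in at_right 0. 0 < r" by (simp add: eventually_at_right_less)
  ultimately have "\<forall>\<^sub>F r in at_right 0. 0 < f r \<and> f r \<le> r - c * r ^ (m + 1) \<and>
      r - C * r ^ (m + 1) \<le> f r \<and> real m * C * r ^ m \<le> 1 / 2"
    using B
  proof eventually_elim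
    case (elim r)
    have "\<bar>f r - (r + a * r ^ (m + 1))\<bar> \<le> (B * r) * r ^ (m + 1)"
      using elim by (simp add: abs_mult power_add power2_eq_square mult_ac)
    also have "\<dots> \<le> (- a / 2) * r ^ (m + 1)"
      using elim by (intro mult_right_mono) auto
    finally have err: "\<bar>f r - (r + a * r ^ (m + 1))\<bar> \<le> (- a / 2) * r ^ (m + 1)" .
    then have bounds: "f r \<le> r - c * r ^ (m + 1)" "r - C * r ^ (m + 1) \<le> f r"
      by (auto simp: c_def C_def abs_le_iff algebra_simps)
    have "1 * (C * r ^ m) \<le> real m * (C * r ^ m)"
      using \<open>1 \<le> m\<close> \<open>a < 0\<close> elim
      by (intro mult_right_mono) (auto simp: C_def mult_nonpos_nonneg)
    then have "C * r ^ m < 1" using elim by (simp add: mult.assoc)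
    then have "0 < r * (1 - C * r ^ m)" using elim by simp
    then have "0 < f r" using bounds(2) by (simp add: algebra_simps)
    then show ?case using bounds elim by simp
  qed
  then show thesis using that unfolding eventually_at_right_field by blast
qed

lemma polar_point_add_full_turns:
  "polar_point r (\<phi> + 2 * pi * of_int n) = polar_point r \<phi>"
  by (simp add: polar_point_def cos_add sin_add)

text \<open>
  After \<open>\<bar>q\<bar>\<close> steps the angle has advanced by \<open>p\<close> full turns, up to the sign of \<open>q\<close>.
\<close>

lemma rational_rotation_periodic:
  fixes p q :: int and k :: nat
  assumes "q \<noteq> 0"
  defines "\<Theta> \<equiv> 2 * pi * of_int p / of_int q" and "Q \<equiv> nat \<bar>q\<bar>"
  shows "polar_point x (\<phi> + real k * \<Theta>) = polar_point x (\<phi> + real (k mod Q) * \<Theta>)"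
proof -
  have "real Q * \<Theta> = 2 * pi * of_int (sgn q * p)"
    using \<open>q \<noteq> 0\<close> by (auto simp: Q_def \<Theta>_def sgn_if abs_if field_simps)
  have "real k = real (k mod Q) + real (k div Q) * real Q"
    by (metis mod_div_mult_eq of_nat_add of_nat_mult)
  then have "\<phi> + real k * \<Theta> = \<phi> + real (k mod Q) * \<Theta> + real (k div Q) * (real Q * \<Theta>)"
    by (simp add: algebra_simps)
  also have "\<dots> = \<phi> + real (k mod Q) * \<Theta> + 2 * pi * of_int (int (k div Q) * (sgn q * p))"
    unfolding \<open>real Q * \<Theta> = _\<close> by simp
  finally show ?thesis by (simp only: polar_point_add_full_turns)
qed

theorem theorem3:
  fixes \<alpha> :: nat and a :: real and f g :: "real \<Rightarrow> real"
    and \<Theta>0 :: real and p q :: int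
  assumes "\<alpha> \<ge> 3" and "odd \<alpha>" and "a < 0"
    and "(\<lambda>r. f r - (r + a * r ^ \<alpha>)) \<in> O[at_right 0](\<lambda>r. r ^ (\<alpha> + 1))"
    and "\<And>\<phi>. g \<phi> = \<phi> + \<Theta>0"
    and "q \<noteq> 0" and "coprime p q"
    and "\<Theta>0 = 2 * pi * of_int p / of_int q"
  shows "\<exists>\<rho>>0. \<forall>r0 \<phi>0. 0 < r0 \<and> r0 < \<rho> \<longrightarrow>
           has_box_dim (discrete_spiral f g r0 \<phi>0) (1 - 1 / real \<alpha>) \<and>
           minkowski_nondegenerate (discrete_spiral f g r0 \<phi>0)"
proof -
  define m where "m = \<alpha> - 1"
  have \<alpha>: "\<alpha> = m + 1" and "1 \<le> m" using \<open>\<alpha> \<ge> 3\<close> by (auto simp: m_def)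
  have "(\<lambda>r. f r - (r + a * r ^ (m + 1))) \<in> O[at_right 0](\<lambda>r. r ^ (m + 2))"
    using assms(4) by (simp add: \<alpha>)
  then obtain \<rho> where "0 < \<rho>" and \<rho>: "\<And>r. 0 < r \<Longrightarrow> r < \<rho> \<Longrightarrow> 0 < f r \<and>
      f r \<le> r - (- a / 2) * r ^ (m + 1) \<and> r - (- 3 * a / 2) * r ^ (m + 1) \<le> f r \<and>
      real m * (- 3 * a / 2) * r ^ m \<le> 1 / 2"
    by (rule weakly_attracting_near_0[OF \<open>1 \<le> m\<close> \<open>a < 0\<close>]) blast
  have "has_box_dim (discrete_spiral f g r0 \<phi>0) (1 - 1 / real \<alpha>) \<and>
      minkowski_nondegenerate (discrete_spiral f g r0 \<phi>0)" if "0 < r0" "r0 < \<rho>" for r0 \<phi>0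
  proof -
    define r where "r k = (f ^^ k) r0" for k
    define \<phi> where "\<phi> k = \<phi>0 + real k * \<Theta>0" for k
    have r: "0 < r k \<and> r k < \<rho>" for k
    proof (induction k)
      case (Suc k)
      then have "0 < (- a / 2) * r k ^ (m + 1)"
        using \<open>a < 0\<close> by (intro mult_pos_pos) auto
      then show ?case using \<rho>[of "r k"] Suc by (auto simp: r_def)
    qed (use that in \<open>simp add: r_def\<close>)
    have "(g ^^ k) \<phi>0 = \<phi> k" for k
      by (induction k) (auto simp: \<phi>_def assms(5) algebra_simps)
    then have "discrete_spiral f g r0 \<phi>0 = range (\<lambda>k. polar_point (r k) (\<phi> k))"
      by (auto simp: discrete_spiral_def r_def)
    moreover have "1 - 1 / real \<alpha> = real m / real (m + 1)" by (simp add: \<alpha> field_simps)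
    moreover have "r (Suc k) \<le> r k - (- a / 2) * r k ^ (m + 1)"
      "r k - (- 3 * a / 2) * r k ^ (m + 1) \<le> r (Suc k)"
      "real m * (- 3 * a / 2) * r k ^ m \<le> 1 / 2" for k
      using \<rho>[of "r k"] r[of k] by (auto simp: r_def)
    moreover have "polar_point x (\<phi> k) = polar_point x (\<phi> (k mod nat \<bar>q\<bar>))" for x k
      unfolding \<phi>_def assms(8) by (rule rational_rotation_periodic[OF \<open>q \<noteq> 0\<close>])
    ultimately show ?thesis
      using \<open>1 \<le> m\<close> \<open>a < 0\<close> \<open>q \<noteq> 0\<close> r
      by (simp only:)
        (rule spiral_box_dim[where c = "- a / 2" and C = "- 3 * a / 2" and Q = "nat \<bar>q\<bar>"], auto)
  qed
  then show ?thesis using \<open>0 < \<rho>\<close> by blast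
qed

end
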